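(* For all integers $m$ and $n\ge1$: $N_{\overline{S}}(m,n)$ equals the number of $\vec\lambda\in\overline{SP}$ with $|\vec\lambda|=n$ and $\overline{\mathrm{crank}}(\vec\lambda)=m$; $N_{\overline{S}_1}(m,n)$ equals the number of $\vec\lambda\in\overline{SP}_1$ with $|\vec\lambda|=n$ and $\overline{\mathrm{crank}}(\vec\lambda)=m$; $N_{\overline{S}_2}(m,n)$ equals the number of $\vec\lambda\in\overline{SP}_2$ with $|\vec\lambda|=n$ and $\overline{\mathrm{crank}}(\vec\lambda)=m$.
   Context: $(a;q)_\infty=\prod_{k\ge0}(1-aq^k)$. The coefficients $N_{\overline{S}}(m,n)$, $N_{\overline{S}_1}(m,n)$, $N_{\overline{S}_2}(m,n)$ are defined by \begin{align*} \sum_{n,m}N_{\overline{S}}(m,n)z^mq^n&=\sum_{n=1}^\infty\frac{q^n(-q^{n+1};q)_\infty(q^{n+1};q)_\infty}{(zq^n;q)_\infty(z^{-1}q^n;q)_\infty},\\ \sum_{n,m}N_{\overline{S}_1}(m,n)z^mq^n&=\sum_{n=0}^\infty\frac{q^{2n+1}(-q^{2n+2};q)_\infty(q^{2n+2};q)_\infty}{(zq^{2n+1};q)_\infty(z^{-1}q^{2n+1};q)_\infty},\\ \sum_{n,m}N_{\overline{S}_2}(m,n)z^mq^n&=\sum_{n=1}^\infty\frac{q^{2n}(-q^{2n+1};q)_\infty(q^{2n+1};q)_\infty}{(zq^{2n};q)_\infty(z^{-1}q^{2n};q)_\infty}. \end{align*} For a partition $\lambda$, $s(\lambda)$ is its smallest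 part ($s(\emptyset)=\infty$) and $|\lambda|$ its sum. $\overline{SP}$ is the set of pairs $\vec\lambda=(\lambda_1,\lambda_2)$ of partitions with $0<s(\lambda_1)\le s(\lambda_2)$ (so $\lambda_1$ is nonempty) such that every part of $\lambda_2$ that is $\ge 2s(\lambda_1)+1$ is odd; $|\vec\lambda|=|\lambda_1|+|\lambda_2|$. $\overline{SP}_1$ (resp. $\overline{SP}_2$) is the subset with $s(\lambda_1)$ odd (resp. even). For $\vec\lambda\in\overline{SP}$, let $k=k(\vec\lambda)$ be the number of parts $j$ of $\lambda_2$ (counted with multiplicity) with $s(\lambda_1)\le j\le 2s(\lambda_1)-1$, and define $\overline{\mathrm{crank}}(\vec\lambda)$ to be (number of parts of $\lambda_1$ that are $\ge s(\lambda_1)+k$) $-\,k$ if $k>0$, and (number of parts of $\lambda_1$) $-1$ if $k=0$. *)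

theory Defs
  imports "HOL-Analysis.Analysis" "HOL-Library.Multiset"
begin

definition qpoch :: "complex \<Rightarrow> complex \<Rightarrow> complex" where
  "qpoch a q = (\<Prod>k. 1 - a * q ^ k)"

definition GF_S :: "complex \<Rightarrow> complex \<Rightarrow> complex" where
  "GF_S z q = (\<Sum>n. let n' = Suc n in
      q ^ n' * qpoch (- (q ^ (n' + 1))) q * qpoch (q ^ (n' + 1)) q
      / (qpoch (z * q ^ n') q * qpoch (q ^ n' / z) q))"

definition GF_S1 :: "complex \<Rightarrow> complex \<Rightarrow> complex" where
  "GF_S1 z q = (\<Sum>n.
      q ^ (2*n+1) * qpoch (- (q ^ (2*n+2))) q * qpoch (q ^ (2*n+2)) q
      / (qpoch (z * q ^ (2*n+1)) q * qpoch (q ^ (2*n+1) / z) q))"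

definition GF_S2 :: "complex \<Rightarrow> complex \<Rightarrow> complex" where
  "GF_S2 z q = (\<Sum>n. let n' = Suc n in
      q ^ (2*n') * qpoch (- (q ^ (2*n'+1))) q * qpoch (q ^ (2*n'+1)) q
      / (qpoch (z * q ^ (2*n')) q * qpoch (q ^ (2*n') / z) q))"

text \<open>Region of convergence used to read off coefficients:
  |q| < 1 and |q| < |z| < 1/|q|.\<close>
definition gf_region :: "complex \<Rightarrow> complex \<Rightarrow> bool" where
  "gf_region z q \<longleftrightarrow> norm q < 1 \<and> norm q < norm z \<and> norm z * norm q < 1"

definition is_gf_coeffs :: "(complex \<Rightarrow> complex \<Rightarrow> complex) \<Rightarrow> (int \<Rightarrow> nat \<Rightarrow> int) \<Rightarrow> bool" where
  "is_gf_coeffs F c \<longleftrightarrow>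
     (\<forall>n. finite {m. c m n \<noteq> 0}) \<and>
     (\<forall>z q. gf_region z q \<longrightarrow>
        (\<lambda>n. (\<Sum>m\<in>{m. c m n \<noteq> 0}. of_int (c m n) * z powi m) * q ^ n) sums F z q)"

definition gf_coeff :: "(complex \<Rightarrow> complex \<Rightarrow> complex) \<Rightarrow> int \<Rightarrow> nat \<Rightarrow> int" where
  "gf_coeff F m n = (THE c. is_gf_coeffs F c) m n"

definition N_S :: "int \<Rightarrow> nat \<Rightarrow> int" where "N_S m n = gf_coeff GF_S m n"
definition N_S1 :: "int \<Rightarrow> nat \<Rightarrow> int" where "N_S1 m n = gf_coeff GF_S1 m n"
definition N_S2 :: "int \<Rightarrow> nat \<Rightarrow> int" where "N_S2 m n = gf_coeff GF_S2 m n"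

definition is_partition :: "nat multiset \<Rightarrow> bool" where
  "is_partition l \<longleftrightarrow> 0 \<notin># l"

definition spart :: "nat multiset \<Rightarrow> nat" where
  "spart l = Min (set_mset l)"

definition SPbar :: "(nat multiset \<times> nat multiset) set" where
  "SPbar = {(l1, l2). is_partition l1 \<and> is_partition l2 \<and> l1 \<noteq> {#} \<and>
              (\<forall>p\<in>#l2. spart l1 \<le> p) \<and>
              (\<forall>p\<in>#l2. 2 * spart l1 + 1 \<le> p \<longrightarrow> odd p)}"

definition SPbar1 :: "(nat multiset \<times> nat multiset) set" where
  "SPbar1 = {v \<in> SPbar. odd (spart (fst v))}"

definition SPbar2 :: "(nat multiset \<times> nat multiset) set" where
  "SPbar2 = {v \<in> SPbar. even (spart (fst v))}"

definition pair_size :: "nat multiset \<times> nat multiset \<Rightarrow> nat" where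
  "pair_size v = sum_mset (fst v) + sum_mset (snd v)"

definition kval :: "nat multiset \<times> nat multiset \<Rightarrow> nat" where
  "kval v = size (filter_mset (\<lambda>j. spart (fst v) \<le> j \<and> j \<le> 2 * spart (fst v) - 1) (snd v))"

definition crank_bar :: "nat multiset \<times> nat multiset \<Rightarrow> int" where
  "crank_bar v = (let s = spart (fst v); k = kval v in
     if k > 0 then int (size (filter_mset (\<lambda>j. s + k \<le> j) (fst v))) - int k
     else int (size (fst v)) - 1)"

end

theory Submission
  imports Defs
begin

text \<open>
  Fix the smallest part \<open>s\<close> of \<open>\<lambda>\<^sub>1\<close>. Since
  \<open>(-q\<^bsup>s+1\<^esup>; q) (q\<^bsup>s+1\<^esup>; q) = (q\<^bsup>2s+2\<^esup>; q\<^sup>2)\<close> and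
  \<open>(q\<^bsup>2s\<^esup>; q) = (1 - q\<^bsup>2s\<^esup>) (q\<^bsup>2s+1\<^esup>; q\<^sup>2) (q\<^bsup>2s+2\<^esup>; q\<^sup>2)\<close>, the \<open>s\<close>-th term of the series is
  \<open>1 / ((1 - q\<^bsup>2s\<^esup>) (q\<^bsup>2s+1\<^esup>; q\<^sup>2))\<close>, which counts the parts of \<open>\<lambda>\<^sub>2\<close> that are at least \<open>2s\<close>,
  times \<open>q\<^sup>s (q\<^bsup>2s\<^esup>; q) / ((zq\<^sup>s; q) (q\<^sup>s/z; q))\<close>. The \<open>q\<close>-binomial theorem with
  \<open>a = zq\<^sup>s\<close> and \<open>t = q\<^sup>s/z\<close> expands the latter as
  \<open>\<Sum>\<^sub>k z\<^bsup>-k\<^esup> q\<^bsup>sk\<^esup> (q\<^sup>s; q)\<^sub>k / (q; q)\<^sub>k \<cdot> q\<^sup>s / ((q\<^sup>s; q)\<^sub>k (zq\<^bsup>s+k\<^esup>; q))\<close>.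
  Here the first fraction is a Gaussian polynomial counting the \<open>k\<close> parts of \<open>\<lambda>\<^sub>2\<close> in
  \<open>[s, 2s - 1]\<close>, and the second one counts \<open>\<lambda>\<^sub>1\<close>, with \<open>z\<close> marking its parts \<open>\<ge> s + k\<close>
  (its obligatory part \<open>s\<close> excepted if \<open>k = 0\<close>).
\<close>

subsection \<open>Infinite products\<close>

lemma convergent_prod_one_minus:
  fixes w :: "nat \<Rightarrow> complex"
  assumes "summable (\<lambda>p. norm (w p))"
  shows "convergent_prod (\<lambda>p. 1 - w p)"
proof -
  have "summable (\<lambda>p. norm ((1 - w p) - 1))"
    using assms by simp
  then show ?thesis
    using abs_convergent_prod_conv_summable abs_convergent_prod_imp_convergent_prod by blast
qed

lemma LIMSEQ_prod_one_minus:
  fixes w :: "nat \<Rightarrow> complex"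
  assumes "summable (\<lambda>p. norm (w p))"
  shows "(\<lambda>N. \<Prod>p<N. 1 - w p) \<longlonglongrightarrow> (\<Prod>p. 1 - w p)"
  using convergent_prod_LIMSEQ[OF convergent_prod_one_minus[OF assms]]
  by (subst filterlim_sequentially_Suc [symmetric]) (simp add: lessThan_Suc_atMost)

lemma prodinf_one_minus_nonzero:
  fixes w :: "nat \<Rightarrow> complex"
  assumes "summable (\<lambda>p. norm (w p))" "\<And>p. norm (w p) < 1"
  shows "(\<Prod>p. 1 - w p) \<noteq> 0"
  using assms by (intro prodinf_nonzero convergent_prod_one_minus) (auto, metis norm_one order_less_irrefl)

lemma norm_mult_power_le:
  fixes a q :: complex
  assumes "norm q < 1"
  shows "norm (a * q ^ n) \<le> norm a"
proof -
  have "norm a * norm q ^ n \<le> norm a * 1"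
    using assms by (intro mult_left_mono power_le_one) auto
  then show ?thesis by (simp add: norm_mult norm_power)
qed

lemma summable_norm_mult_power:
  fixes a q :: complex
  assumes "norm q < 1"
  shows "summable (\<lambda>k. norm (a * q ^ k))"
  using assms by (simp add: norm_mult norm_power summable_mult summable_geometric)

section \<open>Identities and limits for \<open>qpoch\<close>\<close>

lemma LIMSEQ_prod_qpoch:
  assumes "norm q < 1"
  shows "(\<lambda>N. \<Prod>k<N. 1 - a * q ^ k) \<longlonglongrightarrow> qpoch a q"
  unfolding qpoch_def by (intro LIMSEQ_prod_one_minus summable_norm_mult_power assms)

lemma qpoch_nonzero:
  assumes "norm q < 1" "norm a < 1"
  shows "qpoch a q \<noteq> 0"
  unfolding qpoch_def using assms
  by (intro prodinf_one_minus_nonzero summable_norm_mult_power)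
     (auto intro: order.strict_trans1[OF norm_mult_power_le])

lemma prod_lessThan_add:
  fixes f :: "nat \<Rightarrow> 'a::comm_monoid_mult"
  shows "(\<Prod>k<m + n. f k) = (\<Prod>k<m. f k) * (\<Prod>k<n. f (m + k))"
  by (induction n) (simp_all add: algebra_simps)

lemma qpoch_split:
  assumes "norm q < 1"
  shows "qpoch a q = (\<Prod>k<n. 1 - a * q ^ k) * qpoch (a * q ^ n) q"
proof (rule LIMSEQ_unique)
  show "(\<lambda>N. \<Prod>k<n + N. 1 - a * q ^ k) \<longlonglongrightarrow> qpoch a q"
    using LIMSEQ_ignore_initial_segment[OF LIMSEQ_prod_qpoch[OF assms, of a], of n]
    by (simp add: add.commute)
  show "(\<lambda>N. \<Prod>k<n + N. 1 - a * q ^ k) \<longlonglongrightarrow> (\<Prod>k<n. 1 - a * q ^ k) * qpoch (a * q ^ n) q"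
    using tendsto_mult_left[OF LIMSEQ_prod_qpoch[OF assms, of "a * q ^ n"]]
    by (simp add: prod_lessThan_add power_add mult.assoc)
qed

lemma norm_square_less_one: "norm (q::complex) < 1 \<Longrightarrow> norm (q\<^sup>2) < 1"
  by (simp add: norm_power power_less_one_iff)

text \<open>Factor by factor this is a difference of two squares. It merges the two numerator
  products of a series term, with \<open>a = q^(s+1)\<close>.\<close>

lemma qpoch_minus_mult:
  assumes "norm q < 1"
  shows "qpoch (- a) q * qpoch a q = qpoch (a\<^sup>2) (q\<^sup>2)"
proof (rule LIMSEQ_unique)
  have "(\<Prod>k<N. 1 - (- a) * q ^ k) * (\<Prod>k<N. 1 - a * q ^ k) = (\<Prod>k<N. 1 - a\<^sup>2 * (q\<^sup>2) ^ k)" for N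
    unfolding prod.distrib[symmetric]
    by (intro prod.cong refl) (simp add: algebra_simps power2_eq_square power_mult_distrib)
  with tendsto_mult[OF LIMSEQ_prod_qpoch[OF assms, of "-a"] LIMSEQ_prod_qpoch[OF assms, of a]]
  show "(\<lambda>N. \<Prod>k<N. 1 - a\<^sup>2 * (q\<^sup>2) ^ k) \<longlonglongrightarrow> qpoch (- a) q * qpoch a q"
    by simp
  show "(\<lambda>N. \<Prod>k<N. 1 - a\<^sup>2 * (q\<^sup>2) ^ k) \<longlonglongrightarrow> qpoch (a\<^sup>2) (q\<^sup>2)"
    by (intro LIMSEQ_prod_qpoch norm_square_less_one assms)
qed

text \<open>The exponents are separated by parity: \<open>2 * N\<close> factors to base
  \<open>q\<close> are \<open>N\<close> factors of each product to base \<open>q^2\<close>, and a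
  subsequence keeps the limit.\<close>

lemma qpoch_even_odd:
  assumes "norm q < 1"
  shows "qpoch a q = qpoch a (q\<^sup>2) * qpoch (a * q) (q\<^sup>2)"
proof (rule LIMSEQ_unique)
  note lim = LIMSEQ_prod_qpoch[OF norm_square_less_one[OF assms]]
  have "(\<Prod>k<2 * N. 1 - a * q ^ k) =
      (\<Prod>k<N. 1 - a * (q\<^sup>2) ^ k) * (\<Prod>k<N. 1 - a * q * (q\<^sup>2) ^ k)" for N
    by (induction N) (simp_all add: algebra_simps flip: power_mult)
  with tendsto_mult[OF lim[of a] lim[of "a * q"]]
  show "(\<lambda>N. \<Prod>k<2 * N. 1 - a * q ^ k) \<longlonglongrightarrow> qpoch a (q\<^sup>2) * qpoch (a * q) (q\<^sup>2)"
    by simp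
  show "(\<lambda>N. \<Prod>k<2 * N. 1 - a * q ^ k) \<longlonglongrightarrow> qpoch a q"
    using LIMSEQ_subseq_LIMSEQ[OF LIMSEQ_prod_qpoch[OF assms, of a], of "\<lambda>N. 2 * N"]
    by (simp add: strict_mono_def o_def)
qed

text \<open>The shifted product is \<open>qpoch a q\<close> divided by a partial product that itself
  tends to \<open>qpoch a q\<close>, which is nonzero. It later bounds the terms of the
  series.\<close>

lemma LIMSEQ_qpoch_mult_power:
  assumes "norm q < 1" "norm a < 1"
  shows "(\<lambda>n. qpoch (a * q ^ n) q) \<longlonglongrightarrow> 1"
proof -
  have nz: "(\<Prod>k<n. 1 - a * q ^ k) \<noteq> 0" for n
    using qpoch_split[OF assms(1), of a n] qpoch_nonzero[OF assms] by auto
  have "(\<lambda>n. qpoch a q / (\<Prod>k<n. 1 - a * q ^ k)) \<longlonglongrightarrow> qpoch a q / qpoch a q"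
    using qpoch_nonzero[OF assms] by (intro tendsto_intros LIMSEQ_prod_qpoch assms)
  moreover have "qpoch a q / (\<Prod>k<n. 1 - a * q ^ k) = qpoch (a * q ^ n) q" for n
    using qpoch_split[OF assms(1), of a n] nz[of n] by (simp add: field_simps)
  ultimately show ?thesis
    using qpoch_nonzero[OF assms] by simp
qed

lemma one_minus_power_nonzero:
  fixes q :: complex
  assumes "norm q < 1" "n > 0"
  shows "1 - q ^ n \<noteq> 0"
proof -
  have "norm (q ^ n) < 1"
    using assms by (simp add: norm_power power_less_one_iff)
  then show ?thesis by auto
qed

text \<open>
  The series \<open>G\<close> satisfies \<open>(1 - x) G(x) = (1 - ax) G(xq)\<close>; iterate this and use continuity at \<open>0\<close>.
\<close>
lemma q_binomial:
  fixes a t q :: complex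
  assumes q: "norm q < 1" and t: "norm t < 1"
  shows "(\<lambda>k. (\<Prod>i<k. 1 - a * q ^ i) / (\<Prod>i<k. 1 - q ^ Suc i) * t ^ k) sums
           (qpoch (a * t) q / qpoch t q)"
proof -
  define c where "c = (\<lambda>k. (\<Prod>i<k. 1 - a * q ^ i) / (\<Prod>i<k. 1 - q ^ Suc i))"
  define G where "G = (\<lambda>x. \<Sum>k. c k * x ^ k)"
  have c_Suc: "c (Suc k) * (1 - q ^ Suc k) = c k * (1 - a * q ^ k)" for k
    using one_minus_power_nonzero[OF q, of "Suc k"] by (simp add: c_def)
  \<comment> \<open>The coefficients converge and so are bounded; comparison with a geometric series
    then gives convergence of \<open>G\<close> on the open unit disc.\<close>
  have "(\<lambda>k. \<Prod>i<k. 1 - q ^ Suc i) \<longlonglongrightarrow> qpoch q q"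
    using LIMSEQ_prod_qpoch[OF q, of q] by simp
  then have "c \<longlonglongrightarrow> qpoch a q / qpoch q q"
    unfolding c_def using qpoch_nonzero[OF q q]
    by (intro tendsto_intros LIMSEQ_prod_qpoch q)
  then have "Bseq c"
    using convergent_imp_Bseq convergentI by blast
  then obtain K where K: "norm (c n) \<le> K" for n
    by (auto elim!: BseqE)
  have summ: "summable (\<lambda>k. c k * x ^ k)" if "norm x < 1" for x
  proof (rule summable_comparison_test')
    show "summable (\<lambda>k. K * norm x ^ k)"
      using that by (intro summable_mult summable_geometric) auto
    show "norm (c k * x ^ k) \<le> K * norm x ^ k" for k
      unfolding norm_mult norm_power by (intro mult_right_mono K) auto
  qed
  have G: "(\<lambda>k. c k * x ^ k) sums G x" if "norm x < 1" for x
    using summ[OF that] by (simp add: G_def summable_sums)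
  have step: "(1 - x) * G x = (1 - a * x) * G (x * q)" if x: "norm x < 1" for x
  proof -
    have xq: "norm (x * q) < 1"
      using norm_mult_power_le[OF q, of x 1] x by simp
    have "(\<lambda>k. c k * x ^ k - c k * (x * q) ^ k) sums (G x - G (x * q))"
      by (intro sums_diff G x xq)
    \<comment> \<open>The term at \<open>k = 0\<close> is zero, so the index can be shifted and the
      recurrence \<open>c_Suc\<close> applied.\<close>
    then have "(\<lambda>k. c (Suc k) * x ^ Suc k - c (Suc k) * (x * q) ^ Suc k) sums (G x - G (x * q))"
      by (subst sums_Suc_iff) simp
    moreover have "c (Suc k) * x ^ Suc k - c (Suc k) * (x * q) ^ Suc k =
        x * (c k * x ^ k - a * (c k * (x * q) ^ k))" for k
    proof -
      have "c (Suc k) * x ^ Suc k - c (Suc k) * (x * q) ^ Suc k =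
          c (Suc k) * (1 - q ^ Suc k) * x ^ Suc k"
        by (simp add: algebra_simps power_mult_distrib)
      also have "\<dots> = x * (c k * x ^ k - a * (c k * (x * q) ^ k))"
        unfolding c_Suc by (simp add: algebra_simps power_mult_distrib)
      finally show ?thesis .
    qed
    moreover have "(\<lambda>k. x * (c k * x ^ k - a * (c k * (x * q) ^ k))) sums (x * (G x - a * G (x * q)))"
      by (intro sums_mult sums_diff G x xq)
    ultimately have "G x - G (x * q) = x * (G x - a * G (x * q))"
      by (simp add: sums_unique2)
    then show ?thesis by (simp add: algebra_simps)
  qed
  have norm_tq: "norm (t * q ^ N) < 1" for N
    using norm_mult_power_le[OF q, of t N] t by linarith
  have iter: "(\<Prod>i<N. 1 - t * q ^ i) * G t = (\<Prod>i<N. 1 - a * t * q ^ i) * G (t * q ^ N)" for N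
  proof (induction N)
    case (Suc N)
    have "(\<Prod>i<Suc N. 1 - t * q ^ i) * G t = (1 - t * q ^ N) * ((\<Prod>i<N. 1 - t * q ^ i) * G t)"
      by simp
    also have "\<dots> = (\<Prod>i<N. 1 - a * t * q ^ i) * ((1 - t * q ^ N) * G (t * q ^ N))"
      unfolding Suc by simp
    also have "\<dots> = (\<Prod>i<Suc N. 1 - a * t * q ^ i) * G (t * q ^ Suc N)"
      unfolding step[OF norm_tq] by (simp add: algebra_simps)
    finally show ?case .
  qed simp
  have "isCont G 0"
  proof -
    have "summable (\<lambda>k. c k * (1/2) ^ k)" by (rule summ) simp
    then show ?thesis unfolding G_def by (rule isCont_powser) simp
  qed
  moreover have "(\<lambda>N. t * q ^ N) \<longlonglongrightarrow> 0"
    using q by (intro tendsto_mult_right_zero LIMSEQ_power_zero) auto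
  ultimately have "(\<lambda>N. G (t * q ^ N)) \<longlonglongrightarrow> G 0"
    by (rule isCont_tendsto_compose)
  moreover have "G 0 = 1"
    unfolding G_def by (subst powser_zero) (simp add: c_def)
  ultimately have "(\<lambda>N. (\<Prod>i<N. 1 - a * t * q ^ i) * G (t * q ^ N)) \<longlonglongrightarrow> qpoch (a * t) q * 1"
    by (intro tendsto_mult LIMSEQ_prod_qpoch q) auto
  moreover have "(\<lambda>N. (\<Prod>i<N. 1 - t * q ^ i) * G t) \<longlonglongrightarrow> qpoch t q * G t"
    by (intro tendsto_mult LIMSEQ_prod_qpoch q tendsto_const)
  ultimately have "qpoch t q * G t = qpoch (a * t) q"
    unfolding iter by (simp add: LIMSEQ_unique)
  then have "G t = qpoch (a * t) q / qpoch t q"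
    using qpoch_nonzero[OF q t] by (simp add: field_simps)
  then show ?thesis
    using G[OF t] by (simp add: c_def)
qed

subsection \<open>Generating functions of multisets\<close>

text \<open>Unconditional summability in the complex numbers is absolute, so the products are
  absolutely summable over \<open>A \<times> B\<close> and may be summed one coordinate at a
  time.\<close>

lemma has_sum_product_complex:
  fixes f :: "'a \<Rightarrow> complex" and g :: "'b \<Rightarrow> complex"
  assumes f: "(f has_sum a) A" and g: "(g has_sum b) B"
  shows "((\<lambda>(x, y). f x * g y) has_sum (a * b)) (A \<times> B)"
proof (rule has_sum_SigmaI)
  show "((\<lambda>y. case (x, y) of (x, y) \<Rightarrow> f x * g y) has_sum (f x * b)) B" for x
    using has_sum_cmult_right[OF g] by simp
  show "((\<lambda>x. f x * b) has_sum (a * b)) A"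
    by (rule has_sum_cmult_left[OF f])
  have "(\<lambda>xy. norm (case xy of (x, y) \<Rightarrow> f x * g y)) summable_on (A \<times> B)"
    unfolding Infinite_Sum.abs_summable_on_Sigma_iff
  proof (intro conjI ballI)
    have gs: "(\<lambda>y. norm (g y)) summable_on B" and fs: "(\<lambda>x. norm (f x)) summable_on A"
      using f g summable_on_iff_abs_summable_on_complex by (auto simp: summable_on_def)
    show "(\<lambda>y. norm (case (x, y) of (x, y) \<Rightarrow> f x * g y)) summable_on B" for x
      using gs by (simp add: norm_mult summable_on_cmult_right)
    show "(\<lambda>x. norm (\<Sum>\<^sub>\<infinity>y\<in>B. norm (case (x, y) of (x, y) \<Rightarrow> f x * g y))) summable_on A"
      using summable_on_cmult_left[OF fs]
      by (simp add: norm_mult infsum_cmult_right' infsum_nonneg abs_mult)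
  qed
  then show "(\<lambda>(x, y). f x * g y) summable_on (A \<times> B)"
    by (rule abs_summable_summable)
qed

lemma has_sum_geometric:
  fixes x :: complex
  assumes "norm x < 1"
  shows "((\<lambda>j. x ^ j) has_sum (1 / (1 - x))) UNIV"
  using assms by (intro norm_summable_imp_has_sum geometric_sums) (auto simp: norm_power summable_geometric)

lemma has_sum_prod_mset_lessThan:
  fixes w :: "nat \<Rightarrow> complex"
  assumes "\<And>p. p < N \<Longrightarrow> norm (w p) < 1"
  shows "((\<lambda>M. \<Prod>p\<in>#M. w p) has_sum (\<Prod>p<N. 1 / (1 - w p))) {M. set_mset M \<subseteq> {..<N}}"
  using assms
proof (induction N)
  case 0
  show ?case by (simp add: has_sum_finite_iff)
next
  case (Suc N)
  let ?h = "\<lambda>(M, j). M + replicate_mset j N"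
  have bij: "bij_betw ?h ({M. set_mset M \<subseteq> {..<N}} \<times> UNIV) {M. set_mset M \<subseteq> {..<Suc N}}"
  proof (rule bij_betw_byWitness[where f' = "\<lambda>M. (filter_mset (\<lambda>p. p \<noteq> N) M, count M N)"])
    show "\<forall>a\<in>{M. set_mset M \<subseteq> {..<N}} \<times> UNIV.
        (case ?h a of M \<Rightarrow> (filter_mset (\<lambda>p. p \<noteq> N) M, count M N)) = a"
      by (auto simp: multiset_eq_iff count_eq_zero_iff)
    show "\<forall>M\<in>{M. set_mset M \<subseteq> {..<Suc N}}. ?h (filter_mset (\<lambda>p. p \<noteq> N) M, count M N) = M"
      by (auto simp: multiset_eq_iff)
    show "?h ` ({M. set_mset M \<subseteq> {..<N}} \<times> UNIV) \<subseteq> {M. set_mset M \<subseteq> {..<Suc N}}"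
      by (auto split: if_splits)
    show "(\<lambda>M. (filter_mset (\<lambda>p. p \<noteq> N) M, count M N)) ` {M. set_mset M \<subseteq> {..<Suc N}} \<subseteq>
        {M. set_mset M \<subseteq> {..<N}} \<times> UNIV"
      by (auto simp: less_Suc_eq)
  qed
  have "((\<lambda>(M, j). (\<Prod>p\<in>#M. w p) * w N ^ j) has_sum ((\<Prod>p<N. 1 / (1 - w p)) * (1 / (1 - w N))))
      ({M. set_mset M \<subseteq> {..<N}} \<times> UNIV)"
    by (intro has_sum_product_complex Suc.IH has_sum_geometric Suc.prems) auto
  then have "((\<lambda>x. \<Prod>p\<in>#?h x. w p) has_sum (\<Prod>p<Suc N. 1 / (1 - w p)))
      ({M. set_mset M \<subseteq> {..<N}} \<times> UNIV)"
    by (simp add: case_prod_unfold prod_mset_replicate_mset)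
  then show ?case
    by (subst (asm) has_sum_reindex_bij_betw[OF bij])
qed

lemma prod_mset_of_real: "(\<Prod>p\<in>#M. complex_of_real (f p)) = of_real (\<Prod>p\<in>#M. f p)"
  by (induction M) auto

lemma norm_prod_mset: "norm (\<Prod>p\<in>#M. f p) = (\<Prod>p\<in>#M. norm (f p :: complex))"
  by (induction M) (auto simp: norm_mult)

lemma finite_set_mset_subset_lessThan:
  fixes F :: "nat multiset set"
  assumes "finite F"
  obtains N where "F \<subseteq> {M. set_mset M \<subseteq> {..<N}}"
proof -
  have "finite (\<Union>M\<in>F. set_mset M)"
    using assms by auto
  then obtain N where "\<forall>p\<in>(\<Union>M\<in>F. set_mset M). p < N"
    using finite_nat_set_iff_bounded by metis
  then show ?thesis
    by (intro that[of N]) auto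
qed

text \<open>Any finite set of multisets uses only parts below some \<open>N\<close>, so its sum is
  at most the finite product formed with the norms. These products converge as \<open>N\<close>
  grows, which bounds them uniformly.\<close>

lemma abs_summable_prod_mset:
  fixes w :: "nat \<Rightarrow> complex"
  assumes w: "summable (\<lambda>p. norm (w p))" and w1: "\<And>p. norm (w p) < 1"
  shows "(\<lambda>M. norm (\<Prod>p\<in>#M. w p)) summable_on UNIV"
proof -
  \<comment> \<open>The norms are kept as complex numbers so that the finite product formula
    applies; real parts are taken afterwards.\<close>
  define v where "v = (\<lambda>p. complex_of_real (norm (w p)))"
  have v: "summable (\<lambda>p. norm (v p))" "\<And>p. norm (v p) < 1"
    using assms by (auto simp: v_def)
  have "(\<lambda>N. 1 / (\<Prod>p<N. 1 - v p)) \<longlonglongrightarrow> 1 / (\<Prod>p. 1 - v p)"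
    by (intro tendsto_intros LIMSEQ_prod_one_minus prodinf_one_minus_nonzero v)
  then have "Bseq (\<lambda>N. 1 / (\<Prod>p<N. 1 - v p))"
    using convergent_imp_Bseq convergentI by blast
  then obtain K where K: "norm (1 / (\<Prod>p<N. 1 - v p)) \<le> K" for N
    by (auto elim!: BseqE)
  have "(\<Sum>M\<in>F. norm (\<Prod>p\<in>#M. w p)) \<le> K" if F: "finite F" for F
  proof -
    obtain N where N: "F \<subseteq> {M. set_mset M \<subseteq> {..<N}}"
      using finite_set_mset_subset_lessThan[OF F] .
    have hs: "((\<lambda>M. \<Prod>p\<in>#M. v p) has_sum (\<Prod>p<N. 1 / (1 - v p))) {M. set_mset M \<subseteq> {..<N}}"
      by (intro has_sum_prod_mset_lessThan v)
    have "((\<lambda>M. norm (\<Prod>p\<in>#M. w p)) has_sum Re (\<Prod>p<N. 1 / (1 - v p))) {M. set_mset M \<subseteq> {..<N}}"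
      using has_sum_Re[OF hs] by (simp add: v_def prod_mset_of_real norm_prod_mset)
    then have "(\<Sum>M\<in>F. norm (\<Prod>p\<in>#M. w p)) \<le> Re (\<Prod>p<N. 1 / (1 - v p))"
      by (rule finite_sum_le_has_sum) (use F N in auto)
    also have "\<dots> \<le> norm (1 / (\<Prod>p<N. 1 - v p))"
      by (simp add: prod_dividef complex_Re_le_cmod)
    finally show ?thesis using K[of N] by linarith
  qed
  then show ?thesis
    by (intro nonneg_bdd_above_summable_on bdd_aboveI2[where M = K]) auto
qed

text \<open>The sum exists by absolute summability. It is evaluated by comparison with the sums over
  multisets with parts below \<open>N\<close>, whose values are the partial products.\<close>

lemma has_sum_prod_mset:
  fixes w :: "nat \<Rightarrow> complex"
  assumes w: "summable (\<lambda>p. norm (w p))" and w1: "\<And>p. norm (w p) < 1"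
  shows "((\<lambda>M. \<Prod>p\<in>#M. w p) has_sum (1 / (\<Prod>p. 1 - w p))) UNIV"
proof -
  define S where "S = (\<Sum>\<^sub>\<infinity>M. \<Prod>p\<in>#M. w p)"
  have S: "((\<lambda>M. \<Prod>p\<in>#M. w p) has_sum S) UNIV"
    unfolding S_def
    by (rule has_sum_infsum[OF abs_summable_summable[OF abs_summable_prod_mset[OF assms]]])
  have lim: "(\<lambda>N. \<Prod>p<N. 1 / (1 - w p)) \<longlonglongrightarrow> 1 / (\<Prod>p. 1 - w p)"
    unfolding prod_dividef prod.neutral_const
    by (intro tendsto_intros LIMSEQ_prod_one_minus prodinf_one_minus_nonzero assms)
  have "(\<lambda>N. \<Prod>p<N. 1 / (1 - w p)) \<longlonglongrightarrow> S"
  proof (rule LIMSEQ_I)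
    fix e :: real assume "e > 0"
    then have "\<forall>\<^sub>F F in finite_subsets_at_top UNIV. dist (\<Sum>M\<in>F. \<Prod>p\<in>#M. w p) S < e / 2"
      using S unfolding has_sum_def by (intro tendstoD) auto
    then obtain F where F: "finite F"
      and close: "\<And>F'. finite F' \<Longrightarrow> F \<subseteq> F' \<Longrightarrow> dist (\<Sum>M\<in>F'. \<Prod>p\<in>#M. w p) S < e / 2"
      by (auto simp: eventually_finite_subsets_at_top)
    obtain N0 where N0: "F \<subseteq> {M. set_mset M \<subseteq> {..<N0}}"
      using finite_set_mset_subset_lessThan[OF F] .
    show "\<exists>N0. \<forall>N\<ge>N0. norm ((\<Prod>p<N. 1 / (1 - w p)) - S) < e"
    proof (intro exI[of _ N0] allI impI)
      fix N assume "N0 \<le> N"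
      with N0 have FN: "F \<subseteq> {M. set_mset M \<subseteq> {..<N}}"
        by fastforce
      have "((\<lambda>M. \<Prod>p\<in>#M. w p) has_sum (\<Prod>p<N. 1 / (1 - w p))) {M. set_mset M \<subseteq> {..<N}}"
        by (intro has_sum_prod_mset_lessThan w1)
      then have "\<forall>\<^sub>F F in finite_subsets_at_top {M. set_mset M \<subseteq> {..<N}}.
          dist (\<Sum>M\<in>F. \<Prod>p\<in>#M. w p) (\<Prod>p<N. 1 / (1 - w p)) < e / 2"
        unfolding has_sum_def using \<open>e > 0\<close> by (intro tendstoD) auto
      then obtain F1 where F1: "finite F1" "F1 \<subseteq> {M. set_mset M \<subseteq> {..<N}}"
        and close1: "\<And>F'. finite F' \<Longrightarrow> F1 \<subseteq> F' \<Longrightarrow> F' \<subseteq> {M. set_mset M \<subseteq> {..<N}} \<Longrightarrow>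
          dist (\<Sum>M\<in>F'. \<Prod>p\<in>#M. w p) (\<Prod>p<N. 1 / (1 - w p)) < e / 2"
        by (auto simp: eventually_finite_subsets_at_top)
      \<comment> \<open>\<open>F \<union> F1\<close> is large enough for both approximations: the
        sum over it is within \<open>e / 2\<close> of \<open>S\<close> and of the partial
        product.\<close>
      have "dist (\<Prod>p<N. 1 / (1 - w p)) S < e"
        by (rule dist_triangle_half_r[of "\<Sum>M\<in>F \<union> F1. \<Prod>p\<in>#M. w p"])
           (use close[of "F \<union> F1"] close1[of "F \<union> F1"] F F1 FN in auto)
      then show "norm ((\<Prod>p<N. 1 / (1 - w p)) - S) < e"
        by (simp add: dist_norm)
    qed
  qed
  then have "S = 1 / (\<Prod>p. 1 - w p)"
    using lim by (rule LIMSEQ_unique)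
  with S show ?thesis by simp
qed

section \<open>Gaussian polynomials\<close>

lemma finite_multisets_size:
  fixes A :: "'a set"
  assumes "finite A"
  shows "finite {M. set_mset M \<subseteq> A \<and> size M \<le> n}"
proof (rule finite_subset)
  show "finite (mset ` {xs. set xs \<subseteq> A \<and> length xs \<le> n})"
    using finite_lists_length_le[OF assms] by blast
  show "{M. set_mset M \<subseteq> A \<and> size M \<le> n} \<subseteq> mset ` {xs. set xs \<subseteq> A \<and> length xs \<le> n}"
  proof
    fix M assume "M \<in> {M. set_mset M \<subseteq> A \<and> size M \<le> n}"
    moreover obtain xs where "mset xs = M" using ex_mset by blast
    ultimately show "M \<in> mset ` {xs. set xs \<subseteq> A \<and> length xs \<le> n}" by force
  qed
qed

text \<open>This is a Gaussian polynomial, for \<open>k\<close> parts from an interval of length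
  \<open>w\<close>. Both sides satisfy the q-Pascal recurrence, which is why the induction on
  \<open>w\<close> contains one on \<open>k\<close>.\<close>

lemma sum_power_multisets_interval:
  fixes q :: complex
  assumes q: "norm q < 1"
  shows "(\<Sum>M | set_mset M \<subseteq> {s..<s + w} \<and> size M = k. q ^ sum_mset M) =
           q ^ (s * k) * (\<Prod>i<k. 1 - q ^ (w + i)) / (\<Prod>i<k. 1 - q ^ Suc i)"
proof (induction w arbitrary: k)
  case 0
  show ?case
  proof (cases k)
    case 0
    then have "{M. set_mset M \<subseteq> {s..<s + 0} \<and> size M = k} = {{#}}" by auto
    with 0 show ?thesis by simp
  next
    case (Suc j)
    then have "{M. set_mset M \<subseteq> {s..<s + 0} \<and> size M = k} = {}" by auto
    \<comment> \<open>The factor at \<open>i = 0\<close> is \<open>1 - q ^ 0 = 0\<close>, matching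
      the empty sum.\<close>
    with Suc show ?thesis by (simp only: prod.lessThan_Suc_shift) auto
  qed
next
  case (Suc w)
  define X where "X = (\<lambda>w k. {M. set_mset M \<subseteq> {s..<s + w} \<and> size M = k})"
  have fin: "finite (X w k)" for w k
    unfolding X_def by (rule finite_subset[OF _ finite_multisets_size[of "{s..<s + w}" k]]) auto
  have IH: "(\<Sum>M\<in>X w k. q ^ sum_mset M) =
      q ^ (s * k) * (\<Prod>i<k. 1 - q ^ (w + i)) / (\<Prod>i<k. 1 - q ^ Suc i)" for k
    using Suc.IH by (simp add: X_def)
  have "(\<Sum>M\<in>X (Suc w) k. q ^ sum_mset M) =
      q ^ (s * k) * (\<Prod>i<k. 1 - q ^ (Suc w + i)) / (\<Prod>i<k. 1 - q ^ Suc i)"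
  proof (induction k)
    case 0
    have "X (Suc w) 0 = {{#}}" by (auto simp: X_def)
    then show ?case by simp
  next
    case (Suc k)
    \<comment> \<open>Either the largest value \<open>s + w\<close> does not occur, or one copy of
      it is removed; the rest may still contain it, so the second piece keeps the length
      \<open>Suc w\<close>.\<close>
    have split: "X (Suc w) (Suc k) = X w (Suc k) \<union> add_mset (s + w) ` X (Suc w) k"
    proof (intro equalityI subsetI)
      fix M assume M: "M \<in> X (Suc w) (Suc k)"
      show "M \<in> X w (Suc k) \<union> add_mset (s + w) ` X (Suc w) k"
      proof (cases "s + w \<in># M")
        case True
        then obtain M' where "M = add_mset (s + w) M'" by (rule mset_add)
        with M show ?thesis by (auto simp: X_def)
      next
        case False
        then have "p < s + w" if "p \<in># M" for p
          using M that by (cases "p = s + w") (auto simp: X_def subset_iff less_Suc_eq)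
        then show ?thesis using M by (auto simp: X_def subset_iff)
      qed
    qed (auto simp: X_def subset_iff less_Suc_eq)
    have disj: "X w (Suc k) \<inter> add_mset (s + w) ` X (Suc w) k = {}"
      by (auto simp: X_def)
    define P where "P = (\<Prod>i<k. 1 - q ^ (Suc w + i))"
    define D where "D = (\<Prod>i<k. 1 - q ^ Suc i)"
    have D: "D \<noteq> 0" "1 - q ^ Suc k \<noteq> 0"
      unfolding D_def using one_minus_power_nonzero[OF q] by (auto simp del: power_Suc)
    have P0: "(\<Prod>i<Suc k. 1 - q ^ (w + i)) = (1 - q ^ w) * P"
      unfolding P_def by (subst prod.lessThan_Suc_shift) simp
    have P1: "(\<Prod>i<Suc k. 1 - q ^ (Suc w + i)) = P * (1 - q ^ (Suc w + k))"
      by (simp add: P_def)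
    have D1: "(\<Prod>i<Suc k. 1 - q ^ Suc i) = D * (1 - q ^ Suc k)"
      by (simp add: D_def)
    have "(\<Sum>M\<in>X (Suc w) (Suc k). q ^ sum_mset M) =
        (\<Sum>M\<in>X w (Suc k). q ^ sum_mset M) + q ^ (s + w) * (\<Sum>M\<in>X (Suc w) k. q ^ sum_mset M)"
      unfolding split sum.union_disjoint[OF fin finite_imageI[OF fin] disj]
      by (subst sum.reindex) (auto simp: inj_on_def sum_distrib_left power_add)
    also have "\<dots> = q ^ (s * Suc k) * ((1 - q ^ w) * P) / (D * (1 - q ^ Suc k)) +
        q ^ (s + w) * (q ^ (s * k) * P / D)"
      unfolding IH Suc P0 D1 by (simp only: P_def D_def)
    also have "q ^ (s + w) * (q ^ (s * k) * P / D) =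
        q ^ (s * Suc k) * (q ^ w * (1 - q ^ Suc k) * P) / (D * (1 - q ^ Suc k))"
      using D by (simp add: power_add del: power_Suc)
    \<comment> \<open>Over the common denominator,
      \<open>(1 - q^w) + q^w (1 - q^(k+1)) = 1 - q^(w+k+1)\<close>.\<close>
    also have "q ^ (s * Suc k) * ((1 - q ^ w) * P) / (D * (1 - q ^ Suc k)) + \<dots> =
        q ^ (s * Suc k) * (P * (1 - q ^ (Suc w + k))) / (D * (1 - q ^ Suc k))"
      unfolding add_divide_distrib[symmetric] distrib_left[symmetric]
      by (simp add: power_add algebra_simps)
    finally show ?case
      unfolding P1 D1 .
  qed
  then show ?case by (simp add: X_def)
qed

section \<open>Multisets with a lower bound or a parity condition on their parts\<close>

lemma prod_mset_power_filter:
  fixes q z :: "'a::comm_semiring_1"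
  shows "(\<Prod>p\<in>#M. if P p then z * q ^ p else q ^ p) = z ^ size (filter_mset P M) * q ^ sum_mset M"
  by (induction M) (auto simp: power_add mult_ac)

lemma norm_power_less_one: "norm (q::complex) < 1 \<Longrightarrow> n > 0 \<Longrightarrow> norm (q ^ n) < 1"
  by (simp add: norm_power power_less_one_iff)

lemma norm_mult_power_less_one:
  fixes q z :: complex
  assumes "norm q < 1" "norm (z * q) < 1" "n > 0"
  shows "norm (z * q ^ n) < 1"
  using norm_mult_power_le[OF assms(1), of "z * q" "n - 1"] assms(2,3)
  by (simp add: mult.assoc flip: power_Suc)

text \<open>The product formula is used with part weights \<open>0\<close> below \<open>s\<close>,
  \<open>q^p\<close> on \<open>[s, s + k)\<close> and \<open>z q^p\<close> from \<open>s + k\<close>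
  on. Weight \<open>0\<close> removes the multisets with a forbidden part; as \<open>s > 0\<close>,
  the part \<open>0\<close> is among these, so all weights have norm below \<open>1\<close>.\<close>

lemma has_sum_multisets_ge:
  fixes q z :: complex
  assumes q: "norm q < 1" and zq: "norm (z * q) < 1" and s: "s > 0"
  shows "((\<lambda>M. z ^ size (filter_mset (\<lambda>j. s + k \<le> j) M) * q ^ sum_mset M) has_sum
           (1 / ((\<Prod>i<k. 1 - q ^ (s + i)) * qpoch (z * q ^ (s + k)) q))) {M. \<forall>p\<in>#M. s \<le> p}"
proof -
  define w where "w = (\<lambda>p. if p < s then 0 else if s + k \<le> p then z * q ^ p else q ^ p)"
  have w1: "norm (w p) < 1" for p
    using norm_power_less_one[OF q, of p] norm_mult_power_less_one[OF q zq, of p] s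
    by (auto simp: w_def)
  have "summable (\<lambda>p. norm (w p))"
  proof (rule summable_comparison_test')
    show "summable (\<lambda>p. (norm z + 1) * norm q ^ p)"
      using q by (intro summable_mult summable_geometric) auto
    show "norm (norm (w p)) \<le> (norm z + 1) * norm q ^ p" for p
      by (auto simp: w_def norm_mult norm_power algebra_simps)
  qed
  note w = this w1
  have "(\<lambda>N. \<Prod>p<s + k + N. 1 - w p) \<longlonglongrightarrow> (\<Prod>p. 1 - w p)"
    using LIMSEQ_ignore_initial_segment[OF LIMSEQ_prod_one_minus[OF w(1)], of "s + k"]
    by (simp add: add.commute)
  moreover have "(\<Prod>p<s + k + N. 1 - w p) =
      (\<Prod>i<k. 1 - q ^ (s + i)) * (\<Prod>i<N. 1 - z * q ^ (s + k) * q ^ i)" for N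
    by (simp add: prod_lessThan_add w_def power_add mult.assoc)
  moreover have "(\<lambda>N. (\<Prod>i<k. 1 - q ^ (s + i)) * (\<Prod>i<N. 1 - z * q ^ (s + k) * q ^ i)) \<longlonglongrightarrow>
      (\<Prod>i<k. 1 - q ^ (s + i)) * qpoch (z * q ^ (s + k)) q"
    by (intro tendsto_intros LIMSEQ_prod_qpoch q)
  ultimately have "(\<Prod>p. 1 - w p) = (\<Prod>i<k. 1 - q ^ (s + i)) * qpoch (z * q ^ (s + k)) q"
    using LIMSEQ_unique by simp
  with has_sum_prod_mset[OF w] have
    "((\<lambda>M. \<Prod>p\<in>#M. w p) has_sum (1 / ((\<Prod>i<k. 1 - q ^ (s + i)) * qpoch (z * q ^ (s + k)) q))) UNIV"
    by simp
  then show ?thesis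
  proof (rule iffD1[OF has_sum_cong_neutral, rotated -1])
    fix M assume "M \<in> UNIV - {M. \<forall>p\<in>#M. s \<le> p}"
    then show "(\<Prod>p\<in>#M. w p) = 0"
      by (auto simp: w_def prod_mset_zero_iff not_le)
  next
    fix M assume "M \<in> UNIV \<inter> {M. \<forall>p\<in>#M. s \<le> p}"
    then have "(\<Prod>p\<in>#M. w p) = (\<Prod>p\<in>#M. if s + k \<le> p then z * q ^ p else q ^ p)"
      by (intro arg_cong[where f = prod_mset] image_mset_cong) (auto simp: w_def)
    then show "(\<Prod>p\<in>#M. w p) = z ^ size (filter_mset (\<lambda>j. s + k \<le> j) M) * q ^ sum_mset M"
      by (simp add: prod_mset_power_filter)
  qed auto
qed

lemma has_sum_multisets_twice_or_odd:
  fixes q :: complex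
  assumes q: "norm q < 1" and s: "s > 0"
  shows "((\<lambda>M. q ^ sum_mset M) has_sum
           (1 / ((1 - q ^ (2 * s)) * qpoch (q ^ (2 * s + 1)) (q\<^sup>2))))
         {M. \<forall>p\<in>#M. p = 2 * s \<or> 2 * s < p \<and> odd p}"
proof -
  define w where "w = (\<lambda>p. if p = 2 * s \<or> 2 * s < p \<and> odd p then q ^ p else 0)"
  have w1: "norm (w p) < 1" for p
    using norm_power_less_one[OF q, of p] s by (auto simp: w_def)
  have "summable (\<lambda>p. norm (w p))"
  proof (rule summable_comparison_test')
    show "summable (\<lambda>p. norm q ^ p)"
      using q by (intro summable_geometric) auto
    show "norm (norm (w p)) \<le> norm q ^ p" for p
      by (auto simp: w_def norm_power)
  qed
  note w = this w1
  \<comment> \<open>Cutting at \<open>2 * s + 1 + 2 * N\<close> makes each step add one odd part and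
    one even part of weight \<open>0\<close>; for \<open>N = 0\<close> only \<open>2 * s\<close> has
    a weight that counts.\<close>
  have "(\<Prod>p<2 * s + 1 + 2 * N. 1 - w p) =
      (1 - q ^ (2 * s)) * (\<Prod>i<N. 1 - q ^ (2 * s + 1) * (q\<^sup>2) ^ i)" for N
  proof (induction N)
    case 0
    show ?case by (simp add: w_def)
  next
    case (Suc N)
    have "2 * s + 1 + 2 * Suc N = Suc (Suc (2 * s + 1 + 2 * N))" by simp
    moreover have "w (2 * s + 1 + 2 * N) = q ^ (2 * s + 1) * (q\<^sup>2) ^ N"
      "w (Suc (2 * s + 1 + 2 * N)) = 0"
      by (auto simp: w_def power_add simp flip: power_mult)
    ultimately show ?case
      unfolding prod.lessThan_Suc using Suc by simp
  qed
  moreover have "(\<lambda>N. \<Prod>p<2 * s + 1 + 2 * N. 1 - w p) \<longlonglongrightarrow> (\<Prod>p. 1 - w p)"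
    using LIMSEQ_subseq_LIMSEQ[OF LIMSEQ_prod_one_minus[OF w(1)], of "\<lambda>N. 2 * s + 1 + 2 * N"]
    by (simp add: strict_mono_def o_def)
  moreover have "(\<lambda>N. (1 - q ^ (2 * s)) * (\<Prod>i<N. 1 - q ^ (2 * s + 1) * (q\<^sup>2) ^ i)) \<longlonglongrightarrow>
      (1 - q ^ (2 * s)) * qpoch (q ^ (2 * s + 1)) (q\<^sup>2)"
    by (intro tendsto_intros LIMSEQ_prod_qpoch norm_square_less_one q)
  ultimately have "(\<Prod>p. 1 - w p) = (1 - q ^ (2 * s)) * qpoch (q ^ (2 * s + 1)) (q\<^sup>2)"
    using LIMSEQ_unique by simp
  with has_sum_prod_mset[OF w] have
    "((\<lambda>M. \<Prod>p\<in>#M. w p) has_sum (1 / ((1 - q ^ (2 * s)) * qpoch (q ^ (2 * s + 1)) (q\<^sup>2)))) UNIV"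
    by simp
  then show ?thesis
  proof (rule iffD1[OF has_sum_cong_neutral, rotated -1])
    fix M assume "M \<in> UNIV - {M. \<forall>p\<in>#M. p = 2 * s \<or> 2 * s < p \<and> odd p}"
    then show "(\<Prod>p\<in>#M. w p) = 0"
      by (auto simp: w_def prod_mset_zero_iff)
  next
    fix M assume "M \<in> UNIV \<inter> {M. \<forall>p\<in>#M. p = 2 * s \<or> 2 * s < p \<and> odd p}"
    then have "(\<Prod>p\<in>#M. w p) = (\<Prod>p\<in>#M. if False then 1 * q ^ p else q ^ p)"
      by (intro arg_cong[where f = prod_mset] image_mset_cong) (auto simp: w_def)
    then show "(\<Prod>p\<in>#M. w p) = q ^ sum_mset M"
      by (subst (asm) prod_mset_power_filter) simp
  qed auto
qed

subsection \<open>Pairs of partitions with given smallest part and given number of middle parts\<close>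

definition SPbar_fiber :: "nat \<Rightarrow> nat \<Rightarrow> (nat multiset \<times> nat multiset) set" where
  "SPbar_fiber s k = {v \<in> SPbar. spart (fst v) = s \<and> kval v = k}"

definition crank_weight :: "complex \<Rightarrow> complex \<Rightarrow> nat multiset \<times> nat multiset \<Rightarrow> complex" where
  "crank_weight z q v = z powi crank_bar v * q ^ pair_size v"

lemma spart_add_mset:
  assumes "\<forall>p\<in>#M. s \<le> p"
  shows "spart (add_mset s M) = s"
  unfolding spart_def using assms by (intro Min_eqI) auto

lemma spart_in: "M \<noteq> {#} \<Longrightarrow> spart M \<in># M"
  unfolding spart_def by (rule Min_in) auto

lemma spart_le: "p \<in># M \<Longrightarrow> spart M \<le> p"
  unfolding spart_def by (rule Min_le) auto

text \<open>A pair is cut into \<open>\<alpha>\<close>, which is \<open>l1\<close> less one copy of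
  \<open>s\<close>, and the parts of \<open>l2\<close> below \<open>2 * s\<close> (in
  \<open>\<mu>\<close>) and from \<open>2 * s\<close> on (in \<open>\<nu>\<close>). The parity
  condition starts at \<open>2 * s + 1\<close>, so \<open>2 * s\<close> is the one even value
  allowed in \<open>\<nu>\<close>. The bound \<open>s + s\<close> fits the interval lemma with
  \<open>w = s\<close>.\<close>

lemma bij_betw_SPbar_fiber:
  assumes s: "s > 0"
  shows "bij_betw (\<lambda>((\<alpha>, \<mu>), \<nu>). (add_mset s \<alpha>, \<mu> + \<nu>))
           (({M. \<forall>p\<in>#M. s \<le> p} \<times> {M. set_mset M \<subseteq> {s..<s + s} \<and> size M = k}) \<times>
            {M. \<forall>p\<in>#M. p = 2 * s \<or> 2 * s < p \<and> odd p})
           (SPbar_fiber s k)"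
    (is "bij_betw ?f ((?A \<times> ?B) \<times> ?C) _")
proof (rule bij_betw_byWitness[where f' = "\<lambda>(l1, l2).
    ((l1 - {#s#}, filter_mset (\<lambda>p. p < 2 * s) l2), filter_mset (\<lambda>p. 2 * s \<le> p) l2)"])
  have filt: "filter_mset (\<lambda>p. p < 2 * s) \<mu> = \<mu>" "filter_mset (\<lambda>p. 2 * s \<le> p) \<mu> = {#}"
      "filter_mset (\<lambda>j. s \<le> j \<and> j \<le> 2 * s - 1) \<mu> = \<mu>" if "\<mu> \<in> ?B" for \<mu>
    using that by (auto simp: filter_mset_eq_conv filter_mset_eq_mempty_iff) force+
  have filt': "filter_mset (\<lambda>p. p < 2 * s) \<nu> = {#}" "filter_mset (\<lambda>p. 2 * s \<le> p) \<nu> = \<nu>"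
      "filter_mset (\<lambda>j. s \<le> j \<and> j \<le> 2 * s - 1) \<nu> = {#}" if "\<nu> \<in> ?C" for \<nu>
    using that s by (force simp: filter_mset_eq_conv filter_mset_eq_mempty_iff)+
  show "\<forall>a\<in>(?A \<times> ?B) \<times> ?C. (case ?f a of (l1, l2) \<Rightarrow>
      ((l1 - {#s#}, filter_mset (\<lambda>p. p < 2 * s) l2), filter_mset (\<lambda>p. 2 * s \<le> p) l2)) = a"
    using filt filt' by clarsimp
  show "\<forall>v\<in>SPbar_fiber s k. ?f (case v of (l1, l2) \<Rightarrow>
      ((l1 - {#s#}, filter_mset (\<lambda>p. p < 2 * s) l2), filter_mset (\<lambda>p. 2 * s \<le> p) l2)) = v"
  proof clarsimp
    fix l1 l2 assume v: "(l1, l2) \<in> SPbar_fiber s k"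
    then have "s \<in># l1"
      using spart_in by (auto simp: SPbar_fiber_def SPbar_def)
    moreover have "filter_mset (\<lambda>p. p < 2 * s) l2 + filter_mset (\<lambda>p. 2 * s \<le> p) l2 = l2"
      by (auto simp: multiset_eq_iff)
    ultimately show "add_mset s (l1 - {#s#}) = l1 \<and>
        filter_mset (\<lambda>p. p < 2 * s) l2 + filter_mset (\<lambda>p. 2 * s \<le> p) l2 = l2"
      by simp
  qed
  show "?f ` ((?A \<times> ?B) \<times> ?C) \<subseteq> SPbar_fiber s k"
  proof clarify
    fix \<alpha> \<mu> \<nu>
    assume a: "\<forall>p\<in>#\<alpha>. s \<le> p" and m: "set_mset \<mu> \<subseteq> {s..<s + s}" "k = size \<mu>"
      and n: "\<forall>p\<in>#\<nu>. p = 2 * s \<or> 2 * s < p \<and> odd p"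
    have "kval (add_mset s \<alpha>, \<mu> + \<nu>) = size \<mu>"
      using filt(3)[of \<mu>] filt'(3)[of \<nu>] m n by (simp add: kval_def spart_add_mset[OF a])
    then show "(add_mset s \<alpha>, \<mu> + \<nu>) \<in> SPbar_fiber s (size \<mu>)"
      using a m n s by (force simp: SPbar_fiber_def SPbar_def is_partition_def spart_add_mset[OF a])
  qed
  show "(\<lambda>(l1, l2). ((l1 - {#s#}, filter_mset (\<lambda>p. p < 2 * s) l2), filter_mset (\<lambda>p. 2 * s \<le> p) l2)) `
      SPbar_fiber s k \<subseteq> (?A \<times> ?B) \<times> ?C"
  proof (rule image_subsetI)
    fix v assume "v \<in> SPbar_fiber s k"
    moreover obtain l1 l2 where v: "v = (l1, l2)" by (cases v)
    ultimately have sp: "spart l1 = s" and k: "kval (l1, l2) = k"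
      and l2: "\<forall>p\<in>#l2. s \<le> p" "\<forall>p\<in>#l2. 2 * s + 1 \<le> p \<longrightarrow> odd p"
      by (auto simp: SPbar_fiber_def SPbar_def)
    have "filter_mset (\<lambda>j. s \<le> j \<and> j \<le> 2 * s - 1) l2 = filter_mset (\<lambda>p. p < 2 * s) l2"
      using l2 s by (intro filter_mset_cong) auto
    then have "size (filter_mset (\<lambda>p. p < 2 * s) l2) = k"
      using k by (simp add: kval_def sp)
    moreover have "p = 2 * s \<or> 2 * s < p \<and> odd p" if "p \<in># l2" "2 * s \<le> p" for p
      using l2(2) that by (cases "p = 2 * s") auto
    ultimately show "(case v of (l1, l2) \<Rightarrow> ((l1 - {#s#}, filter_mset (\<lambda>p. p < 2 * s) l2),
        filter_mset (\<lambda>p. 2 * s \<le> p) l2)) \<in> (?A \<times> ?B) \<times> ?C"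
      using spart_le[of _ l1] sp l2(1) by (auto simp: v dest!: in_diffD)
  qed
qed

text \<open>The two cases of the crank become one formula: for \<open>k > 0\<close> the removed part
  \<open>s\<close> lies below \<open>s + k\<close> and was not counted, for \<open>k = 0\<close> its
  removal accounts for the \<open>- 1\<close>.\<close>

lemma crank_weight_add_mset:
  assumes z: "z \<noteq> 0" and s: "s > 0" and a: "\<forall>p\<in>#\<alpha>. s \<le> p"
    and v: "(add_mset s \<alpha>, \<mu> + \<nu>) \<in> SPbar_fiber s k"
  shows "crank_weight z q (add_mset s \<alpha>, \<mu> + \<nu>) = q ^ s * z powi (- int k) *
           ((z ^ size (filter_mset (\<lambda>j. s + k \<le> j) \<alpha>) * q ^ sum_mset \<alpha>) * q ^ sum_mset \<mu> * q ^ sum_mset \<nu>)"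
proof -
  have k: "kval (add_mset s \<alpha>, \<mu> + \<nu>) = k"
    using v by (simp add: SPbar_fiber_def)
  have crank: "crank_bar (add_mset s \<alpha>, \<mu> + \<nu>) = int (size (filter_mset (\<lambda>j. s + k \<le> j) \<alpha>)) - int k"
  proof (cases "k = 0")
    case True
    moreover have "filter_mset (\<lambda>j. s \<le> j) \<alpha> = \<alpha>"
      using a by (auto simp: filter_mset_eq_conv)
    ultimately show ?thesis by (simp add: crank_bar_def k)
  qed (simp add: crank_bar_def k spart_add_mset[OF a])
  have "z powi crank_bar (add_mset s \<alpha>, \<mu> + \<nu>) =
      z powi (- int k) * z ^ size (filter_mset (\<lambda>j. s + k \<le> j) \<alpha>)"
    unfolding crank using z by (simp add: power_int_diff power_int_minus field_simps)
  then show ?thesis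
    by (simp add: crank_weight_def pair_size_def power_add mult_ac)
qed

definition crank_term :: "complex \<Rightarrow> complex \<Rightarrow> nat \<Rightarrow> complex" where
  "crank_term z q s = q ^ s * qpoch (- (q ^ (s + 1))) q * qpoch (q ^ (s + 1)) q
      / (qpoch (z * q ^ s) q * qpoch (q ^ s / z) q)"

text \<open>The three factors in the outer parentheses are the sums over \<open>\<alpha>\<close>,
  \<open>\<mu>\<close> and \<open>\<nu>\<close>, left uncancelled so that the product rule for sums
  yields exactly this expression.\<close>

definition fiber_sum :: "complex \<Rightarrow> complex \<Rightarrow> nat \<Rightarrow> nat \<Rightarrow> complex" where
  "fiber_sum z q s k = q ^ s * z powi (- int k) *
     (1 / ((\<Prod>i<k. 1 - q ^ (s + i)) * qpoch (z * q ^ (s + k)) q) *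
      (q ^ (s * k) * (\<Prod>i<k. 1 - q ^ (s + i)) / (\<Prod>i<k. 1 - q ^ Suc i)) *
      (1 / ((1 - q ^ (2 * s)) * qpoch (q ^ (2 * s + 1)) (q\<^sup>2))))"

lemma gf_regionD:
  assumes "gf_region z q"
  shows "norm q < 1" "norm (z * q) < 1" "norm (inverse z * q) < 1" "z \<noteq> 0"
proof -
  show z: "z \<noteq> 0" and "norm q < 1" "norm (z * q) < 1"
    using assms by (auto simp: gf_region_def norm_mult)
  show "norm (inverse z * q) < 1"
    using assms z by (simp add: gf_region_def norm_mult norm_inverse norm_divide divide_simps)
qed

lemma has_sum_SPbar_fiber:
  assumes zq: "gf_region z q" and s: "s > 0"
  shows "(crank_weight z q has_sum fiber_sum z q s k) (SPbar_fiber s k)"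
proof -
  note r = gf_regionD[OF zq]
  let ?A = "{M. \<forall>p\<in>#M. s \<le> p}" and ?B = "{M. set_mset M \<subseteq> {s..<s + s} \<and> size M = k}"
    and ?C = "{M. \<forall>p\<in>#M. p = 2 * s \<or> 2 * s < p \<and> odd p}"
  let ?f = "\<lambda>((\<alpha>, \<mu>), \<nu>). (add_mset s \<alpha>, \<mu> + \<nu>)"
  have "finite ?B"
    by (rule finite_subset[OF _ finite_multisets_size[of "{s..<s + s}" k]]) auto
  then have B: "((\<lambda>M. q ^ sum_mset M) has_sum
      (q ^ (s * k) * (\<Prod>i<k. 1 - q ^ (s + i)) / (\<Prod>i<k. 1 - q ^ Suc i))) ?B"
    using sum_power_multisets_interval[OF r(1), of s s k] by (intro has_sum_finiteI) auto
  have "((\<lambda>x. q ^ s * z powi (- int k) * (case x of (y, \<nu>) \<Rightarrow> (case y of (\<alpha>, \<mu>) \<Rightarrow>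
      (z ^ size (filter_mset (\<lambda>j. s + k \<le> j) \<alpha>) * q ^ sum_mset \<alpha>) * q ^ sum_mset \<mu>) * q ^ sum_mset \<nu>))
      has_sum fiber_sum z q s k) ((?A \<times> ?B) \<times> ?C)"
    unfolding fiber_sum_def
    by (intro has_sum_cmult_right has_sum_product_complex has_sum_multisets_ge
        has_sum_multisets_twice_or_odd B r s)
  then have "((\<lambda>x. crank_weight z q (?f x)) has_sum fiber_sum z q s k) ((?A \<times> ?B) \<times> ?C)"
  proof (rule iffD1[OF has_sum_cong, rotated])
    fix x assume x: "x \<in> (?A \<times> ?B) \<times> ?C"
    then have "?f x \<in> SPbar_fiber s k"
      by (rule bij_betw_apply[OF bij_betw_SPbar_fiber[OF s]])
    with x show "q ^ s * z powi (- int k) * (case x of (y, \<nu>) \<Rightarrow> (case y of (\<alpha>, \<mu>) \<Rightarrow>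
      (z ^ size (filter_mset (\<lambda>j. s + k \<le> j) \<alpha>) * q ^ sum_mset \<alpha>) * q ^ sum_mset \<mu>) * q ^ sum_mset \<nu>)
      = crank_weight z q (?f x)"
      using crank_weight_add_mset[OF r(4) s] by auto
  qed
  then show ?thesis
    by (subst (asm) has_sum_reindex_bij_betw[OF bij_betw_SPbar_fiber[OF s]])
qed

lemma fiber_sum_sums:
  assumes zq: "gf_region z q" and s: "s > 0"
  shows "fiber_sum z q s sums crank_term z q s"
proof -
  note r = gf_regionD[OF zq]
  have n1: "norm (z * q ^ s) < 1" and n2: "norm (q ^ s / z) < 1" and n3: "norm (q ^ (2 * s + 1)) < 1"
    using norm_mult_power_less_one[OF r(1,2) s] norm_mult_power_less_one[OF r(1,3) s]
      norm_power_less_one[OF r(1), of "2 * s + 1"] by (auto simp: field_simps)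
  define R where "R = qpoch (q ^ (2 * s + 1)) (q\<^sup>2)"
  have R: "R \<noteq> 0"
    unfolding R_def by (intro qpoch_nonzero norm_square_less_one r n3)
  have e: "1 - q ^ (2 * s) \<noteq> 0"
    using one_minus_power_nonzero[OF r(1)] s by simp
  have Q: "qpoch (z * q ^ s) q \<noteq> 0"
    by (intro qpoch_nonzero r n1)
  \<comment> \<open>\<open>c\<close> gathers what does not depend on \<open>k\<close>. Writing
    \<open>qpoch (z * q ^ (s + k)) q\<close> as a quotient by a finite product puts the numerator of
    the q-binomial coefficient in place.\<close>
  define c where "c = q ^ s / (qpoch (z * q ^ s) q * (1 - q ^ (2 * s)) * R)"
  have eq: "fiber_sum z q s k =
      c * ((\<Prod>i<k. 1 - z * q ^ s * q ^ i) / (\<Prod>i<k. 1 - q ^ Suc i) * (q ^ s / z) ^ k)" for k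
  proof -
    have P: "(\<Prod>i<k. 1 - q ^ (s + i)) \<noteq> 0"
      using one_minus_power_nonzero[OF r(1)] s by auto
    have D: "(\<Prod>i<k. 1 - q ^ Suc i) \<noteq> 0"
      using one_minus_power_nonzero[OF r(1)] by (auto simp del: power_Suc)
    have split: "qpoch (z * q ^ s) q = (\<Prod>i<k. 1 - z * q ^ s * q ^ i) * qpoch (z * q ^ (s + k)) q"
      using qpoch_split[OF r(1), of "z * q ^ s" k] by (simp add: power_add mult.assoc)
    with Q have "qpoch (z * q ^ (s + k)) q \<noteq> 0" "(\<Prod>i<k. 1 - z * q ^ s * q ^ i) \<noteq> 0"
      by (metis mult_zero_right, metis mult_zero_left)
    with P D R e r(4) show ?thesis
      unfolding fiber_sum_def c_def split R_def[symmetric]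
      by (simp add: power_int_minus divide_simps power_mult power_divide del: power_Suc)
  qed
  have lim: "(\<lambda>k. c * ((\<Prod>i<k. 1 - z * q ^ s * q ^ i) / (\<Prod>i<k. 1 - q ^ Suc i) * (q ^ s / z) ^ k))
      sums (c * (qpoch (z * q ^ s * (q ^ s / z)) q / qpoch (q ^ s / z) q))"
    by (intro sums_mult q_binomial r n2)
  have val: "c * (qpoch (z * q ^ s * (q ^ s / z)) q / qpoch (q ^ s / z) q) = crank_term z q s"
  proof -
    \<comment> \<open>Since \<open>a t = q^(2 * s)\<close>, splitting off the first factor and then
      the odd exponents isolates \<open>(1 - q^(2 * s)) * R\<close>, which cancels against
      \<open>c\<close>; the even exponents form the numerator of the term.\<close>
    have "qpoch (z * q ^ s * (q ^ s / z)) q = qpoch (q ^ (2 * s)) q"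
      using r(4) by (simp add: mult_2 power_add)
    also have "\<dots> = (1 - q ^ (2 * s)) * qpoch (q ^ (2 * s + 1)) q"
      using qpoch_split[OF r(1), of "q ^ (2 * s)" 1] by (simp add: mult.commute)
    also have "qpoch (q ^ (2 * s + 1)) q = R * qpoch (q ^ (2 * s + 2)) (q\<^sup>2)"
      using qpoch_even_odd[OF r(1), of "q ^ (2 * s + 1)"] by (simp add: R_def mult.commute)
    also have "q ^ (2 * s + 2) = (q ^ (s + 1))\<^sup>2"
      by (simp add: power2_eq_square mult_2 power_add)
    also have "qpoch ((q ^ (s + 1))\<^sup>2) (q\<^sup>2) = qpoch (- (q ^ (s + 1))) q * qpoch (q ^ (s + 1)) q"
      by (rule qpoch_minus_mult[OF r(1), symmetric])
    finally show ?thesis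
      using R e by (simp add: c_def crank_term_def)
  qed
  have "fiber_sum z q s =
      (\<lambda>k. c * ((\<Prod>i<k. 1 - z * q ^ s * q ^ i) / (\<Prod>i<k. 1 - q ^ Suc i) * (q ^ s / z) ^ k))"
    by (rule ext) (rule eq)
  with lim show ?thesis
    unfolding val by (simp only:)
qed

subsection \<open>Summation over all pairs\<close>

text \<open>
  Absolute summability over all pairs reduces to the same identities at
  \<open>(\<bar>z\<bar>, \<bar>q\<bar>)\<close>, where every term is nonnegative.
\<close>
lemma crank_weight_norm:
  "crank_weight (of_real (norm z)) (of_real (norm q)) v = of_real (norm (crank_weight z q v))"
  by (simp add: crank_weight_def norm_mult norm_power norm_power_int of_real_power_int)

lemma gf_region_norm:
  "gf_region z q \<Longrightarrow> gf_region (of_real (norm z)) (of_real (norm q))"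
  by (simp add: gf_region_def)

text \<open>The term at \<open>Suc n\<close> is \<open>q^(Suc n)\<close> times a quotient tending to
  \<open>1\<close>, hence bounded, so a geometric series dominates.\<close>

lemma summable_crank_term:
  assumes zq: "gf_region z q"
  shows "(\<lambda>s. norm (crank_term z q s)) summable_on {0<..}"
proof -
  note r = gf_regionD[OF zq]
  define B where "B = (\<lambda>n. qpoch (- q\<^sup>2 * q ^ n) q * qpoch (q\<^sup>2 * q ^ n) q
      / (qpoch (z * q * q ^ n) q * qpoch (inverse z * q * q ^ n) q))"
  have q2: "norm (q\<^sup>2) < 1" "norm (- q\<^sup>2) < 1"
    using norm_square_less_one[OF r(1)] by auto
  have "B \<longlonglongrightarrow> 1 * 1 / (1 * 1)"
    unfolding B_def by (intro tendsto_intros LIMSEQ_qpoch_mult_power r q2) simp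
  then have "Bseq B"
    using convergent_imp_Bseq convergentI by blast
  then obtain K where K: "norm (B n) \<le> K" for n
    by (auto elim!: BseqE)
  have eq: "crank_term z q (Suc n) = q ^ Suc n * B n" for n
    using r(4) by (simp add: crank_term_def B_def power2_eq_square field_simps)
  have "summable (\<lambda>n. norm (crank_term z q (Suc n)))"
  proof (rule summable_comparison_test')
    show "summable (\<lambda>n. K * norm q * norm q ^ n)"
      using r(1) by (intro summable_mult summable_geometric) simp
    show "norm (norm (crank_term z q (Suc n))) \<le> K * norm q * norm q ^ n" for n
      using mult_left_mono[OF K[of n], of "norm q * norm q ^ n"]
      by (simp add: eq norm_mult norm_power mult_ac)
  qed
  then have "(\<lambda>n. norm (crank_term z q (Suc n))) summable_on UNIV"
    by (intro norm_summable_imp_summable_on) simp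
  then have "(\<lambda>s. norm (crank_term z q s)) summable_on range Suc"
    by (subst summable_on_reindex) (simp_all add: o_def)
  moreover have "range Suc = {0<..}"
    by (auto simp: image_iff gr0_conv_Suc)
  ultimately show ?thesis by simp
qed

lemma has_sum_SPbar:
  assumes zq: "gf_region z q" and S: "S \<subseteq> {0<..}"
  shows "(crank_weight z q has_sum (\<Sum>\<^sub>\<infinity>s\<in>S. crank_term z q s)) {v \<in> SPbar. spart (fst v) \<in> S}"
proof -
  let ?Sig = "Sigma S (\<lambda>s. Sigma UNIV (SPbar_fiber s))"
  let ?g = "\<lambda>(s, k, v). v"
  have bij: "bij_betw ?g ?Sig {v \<in> SPbar. spart (fst v) \<in> S}"
    by (rule bij_betw_byWitness[where f' = "\<lambda>v. (spart (fst v), kval v, v)"])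
       (auto simp: SPbar_fiber_def)
  define z' where "z' = complex_of_real (norm z)"
  define q' where "q' = complex_of_real (norm q)"
  have zq': "gf_region z' q'"
    unfolding z'_def q'_def by (rule gf_region_norm[OF zq])
  have fib: "((\<lambda>v. norm (crank_weight z q v)) has_sum Re (fiber_sum z' q' s k)) (SPbar_fiber s k)"
    if "s \<in> S" for s k
  proof -
    have "(crank_weight z' q' has_sum fiber_sum z' q' s k) (SPbar_fiber s k)"
      using that S by (intro has_sum_SPbar_fiber zq') auto
    from has_sum_Re[OF this] show ?thesis
      by (simp add: z'_def q'_def crank_weight_norm)
  qed
  \<comment> \<open>A convergent series of nonnegative terms is unconditionally summable; this is
    where passing to norms pays off.\<close>
  have row: "((\<lambda>k. Re (fiber_sum z' q' s k)) has_sum Re (crank_term z' q' s)) UNIV" if s: "s \<in> S" for s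
  proof (rule sums_nonneg_imp_has_sum)
    show "(\<lambda>k. Re (fiber_sum z' q' s k)) sums Re (crank_term z' q' s)"
      using s S by (intro sums_Re fiber_sum_sums zq') auto
    show "Re (fiber_sum z' q' s k) \<ge> 0" for k
      by (rule has_sum_nonneg[OF fib[OF s]]) auto
  qed
  have rows: "((\<lambda>x. norm (crank_weight z q (snd x))) has_sum Re (crank_term z' q' s))
      (Sigma UNIV (SPbar_fiber s))" if s: "s \<in> S" for s
  proof (rule has_sum_SigmaI)
    show "((\<lambda>v. norm (crank_weight z q (snd (k, v)))) has_sum Re (fiber_sum z' q' s k))
        (SPbar_fiber s k)" for k
      using fib[OF s] by simp
    show "((\<lambda>k. Re (fiber_sum z' q' s k)) has_sum Re (crank_term z' q' s)) UNIV"
      by (rule row[OF s])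
    show "(\<lambda>x. norm (crank_weight z q (snd x))) summable_on (Sigma UNIV (SPbar_fiber s))"
    proof (rule summable_on_SigmaI)
      show "((\<lambda>v. norm (crank_weight z q (snd (k, v)))) has_sum Re (fiber_sum z' q' s k))
          (SPbar_fiber s k)" for k
        using fib[OF s] by simp
      show "(\<lambda>k. Re (fiber_sum z' q' s k)) summable_on UNIV"
        using row[OF s] by (auto simp: summable_on_def)
    qed auto
  qed
  have "(\<lambda>x. norm (crank_weight z q (?g x))) summable_on ?Sig"
  proof (rule summable_on_SigmaI)
    show "((\<lambda>y. norm (crank_weight z q (?g (s, y)))) has_sum Re (crank_term z' q' s))
        (Sigma UNIV (SPbar_fiber s))" if "s \<in> S" for s
      using rows[OF that] by (simp add: case_prod_unfold)
    have "(\<lambda>s. norm (crank_term z' q' s)) summable_on S"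
      by (rule summable_on_subset_banach[OF summable_crank_term[OF zq'] S])
    then show "(\<lambda>s. Re (crank_term z' q' s)) summable_on S"
      by (rule summable_on_Re[OF abs_summable_summable])
  qed auto
  then have summ: "(\<lambda>x. crank_weight z q (?g x)) summable_on ?Sig"
    by (rule abs_summable_summable)
  have inner: "((\<lambda>x. crank_weight z q (snd x)) has_sum crank_term z q s) (Sigma UNIV (SPbar_fiber s))"
    if s: "s \<in> S" for s
  proof -
    \<comment> \<open>\<open>fiber_sum_sums\<close> gives an ordered series only, so the unordered
      sum is first shown to exist with some value \<open>R\<close>, which the ordered series then
      identifies.\<close>
    have "(\<lambda>x. crank_weight z q (snd x)) summable_on (Sigma UNIV (SPbar_fiber s))"
      using rows[OF s] by (intro abs_summable_summable[of "\<lambda>x. crank_weight z q (snd x)"] has_sum_imp_summable)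
    then obtain R where R: "((\<lambda>x. crank_weight z q (snd x)) has_sum R) (Sigma UNIV (SPbar_fiber s))"
      by (auto simp: summable_on_def)
    have "(fiber_sum z q s has_sum R) UNIV"
      using s S by (intro has_sum_SigmaD[OF R]) (auto intro!: has_sum_SPbar_fiber zq)
    then have "fiber_sum z q s sums R"
      by (rule has_sum_imp_sums)
    moreover have "fiber_sum z q s sums crank_term z q s"
      using s S by (intro fiber_sum_sums zq) auto
    ultimately show ?thesis
      using R sums_unique2 by blast
  qed
  have "((\<lambda>x. crank_weight z q (?g x)) has_sum (\<Sum>\<^sub>\<infinity>s\<in>S. crank_term z q s)) ?Sig"
  proof (rule has_sum_SigmaI[OF _ _ summ])
    show "((\<lambda>y. crank_weight z q (?g (s, y))) has_sum crank_term z q s) (Sigma UNIV (SPbar_fiber s))"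
      if "s \<in> S" for s
      using inner[OF that] by (simp add: case_prod_unfold)
    have "(\<lambda>s. norm (crank_term z q s)) summable_on S"
      by (rule summable_on_subset_banach[OF summable_crank_term[OF zq] S])
    then show "(crank_term z q has_sum (\<Sum>\<^sub>\<infinity>s\<in>S. crank_term z q s)) S"
      by (rule has_sum_infsum[OF abs_summable_summable])
  qed
  then show ?thesis
    by (subst (asm) has_sum_reindex_bij_betw[OF bij])
qed

lemma has_sum_SPbar_enumeration:
  assumes zq: "gf_region z q" and f: "inj f" "\<And>n. f n > (0::nat)"
  shows "(crank_weight z q has_sum (\<Sum>n. crank_term z q (f n))) {v \<in> SPbar. spart (fst v) \<in> range f}"
proof -
  have range: "range f \<subseteq> {0<..}" using f by auto
  have "(\<lambda>s. norm (crank_term z q s)) summable_on range f"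
    by (rule summable_on_subset_banach[OF summable_crank_term[OF zq] range])
  then have "(crank_term z q has_sum (\<Sum>\<^sub>\<infinity>s\<in>range f. crank_term z q s)) (range f)"
    by (rule has_sum_infsum[OF abs_summable_summable])
  then have "((\<lambda>n. crank_term z q (f n)) has_sum (\<Sum>\<^sub>\<infinity>s\<in>range f. crank_term z q s)) UNIV"
    by (subst (asm) has_sum_reindex) (simp_all add: f o_def)
  then have "(\<Sum>n. crank_term z q (f n)) = (\<Sum>\<^sub>\<infinity>s\<in>range f. crank_term z q s)"
    using has_sum_imp_sums sums_unique by metis
  then show ?thesis
    using has_sum_SPbar[OF zq range] by simp
qed

subsection \<open>Reading off coefficients\<close>

lemma size_le_sum_mset: "0 \<notin># M \<Longrightarrow> size M \<le> sum_mset (M :: nat multiset)"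
  by (induction M) auto

lemma finite_SPbar_pair_size: "finite {v \<in> SPbar. pair_size v = n}"
proof -
  let ?X = "{M. set_mset M \<subseteq> {..n} \<and> size M \<le> n}"
  have "{v \<in> SPbar. pair_size v = n} \<subseteq> ?X \<times> ?X"
  proof
    fix v assume "v \<in> {v \<in> SPbar. pair_size v = n}"
    then obtain l1 l2 where v: "v = (l1, l2)" and l: "0 \<notin># l1" "0 \<notin># l2"
      and n: "sum_mset l1 + sum_mset l2 = n"
      by (auto simp: SPbar_def is_partition_def pair_size_def)
    have "M \<in> ?X" if "0 \<notin># M" "sum_mset M \<le> n" for M
    proof -
      have "p \<le> n" if "p \<in># M" for p
        using sum_mset.remove[OF that] \<open>sum_mset M \<le> n\<close> by simp
      then show ?thesis
        using size_le_sum_mset[OF that(1)] that(2) by auto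
    qed
    with v l n show "v \<in> ?X \<times> ?X" by auto
  qed
  then show ?thesis
    by (rule finite_subset) (intro finite_cartesian_product finite_multisets_size finite_atMost)
qed

text \<open>Pairs are regrouped first by size and then by crank. Each size class is finite, so it
  contributes a Laurent polynomial in \<open>z\<close>, whose coefficients are
  cardinalities.\<close>

lemma is_gf_coeffs_card:
  assumes A: "A \<subseteq> SPbar"
    and F: "\<And>z q. gf_region z q \<Longrightarrow> (crank_weight z q has_sum F z q) A"
  shows "is_gf_coeffs F (\<lambda>m n. int (card {v \<in> A. pair_size v = n \<and> crank_bar v = m}))"
proof -
  define c where "c = (\<lambda>m n. int (card {v \<in> A. pair_size v = n \<and> crank_bar v = m}))"
  define An where "An = (\<lambda>n. {v \<in> A. pair_size v = n})"
  have fin: "finite (An n)" for n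
    by (rule finite_subset[OF _ finite_SPbar_pair_size[of n]]) (use A in \<open>auto simp: An_def\<close>)
  have c: "c m n = int (card {v \<in> An n. crank_bar v = m})" for m n
    by (simp add: c_def An_def conj_assoc)
  have supp: "{m. c m n \<noteq> 0} = crank_bar ` An n" for n
    using fin by (auto simp: c card_eq_0_iff)
  have "(\<lambda>n. (\<Sum>m\<in>{m. c m n \<noteq> 0}. of_int (c m n) * z powi m) * q ^ n) sums F z q"
    if zq: "gf_region z q" for z q
  proof -
    have bij: "bij_betw snd (Sigma UNIV An) A"
      by (rule bij_betw_byWitness[where f' = "\<lambda>v. (pair_size v, v)"]) (auto simp: An_def)
    have "((\<lambda>x. crank_weight z q (snd x)) has_sum F z q) (Sigma UNIV An)"
      using F[OF zq] by (subst has_sum_reindex_bij_betw[OF bij])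
    then have "((\<lambda>n. \<Sum>v\<in>An n. crank_weight z q v) has_sum F z q) UNIV"
      by (rule has_sum_SigmaD) (auto intro!: has_sum_finiteI fin)
    moreover have "(\<Sum>v\<in>An n. crank_weight z q v) =
        (\<Sum>m\<in>{m. c m n \<noteq> 0}. of_int (c m n) * z powi m) * q ^ n" for n
    proof -
      have "(\<Sum>v\<in>An n. crank_weight z q v) =
          (\<Sum>m\<in>crank_bar ` An n. \<Sum>v\<in>{v \<in> An n. crank_bar v = m}. crank_weight z q v)"
        by (rule sum.group[symmetric]) (auto intro: fin)
      also have "\<dots> = (\<Sum>m\<in>crank_bar ` An n. \<Sum>v\<in>{v \<in> An n. crank_bar v = m}. z powi m * q ^ n)"
        by (intro sum.cong refl) (auto simp: crank_weight_def An_def)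
      finally show ?thesis
        unfolding supp by (simp add: c sum_distrib_right mult.assoc)
    qed
    ultimately show ?thesis
      using has_sum_imp_sums by simp
  qed
  then show ?thesis
    unfolding is_gf_coeffs_def c_def[symmetric] using fin by (simp add: supp)
qed

section \<open>Uniqueness of the coefficients\<close>

text \<open>The limit at \<open>0\<close> yields the constant coefficient; dividing by
  \<open>x\<close> shifts the series and the induction continues. This division is why the
  hypothesis speaks of \<open>x \<noteq> 0\<close>.\<close>

lemma powser_zero_imp_coeff_zero:
  fixes d :: "nat \<Rightarrow> complex"
  assumes "r > 0" "\<And>x. x \<noteq> 0 \<Longrightarrow> norm x < r \<Longrightarrow> (\<lambda>n. d n * x ^ n) sums 0"
  shows "d n = 0"
  using assms(2)
proof (induction n arbitrary: d)
  case 0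
  have "((\<lambda>x. 0) \<longlongrightarrow> d 0) (at (0::complex))"
    by (rule powser_limit_0_strong[OF assms(1)]) (rule 0)
  then show ?case by (simp add: tendsto_const_iff)
next
  case (Suc n)
  have "((\<lambda>x. 0) \<longlongrightarrow> d 0) (at (0::complex))"
    by (rule powser_limit_0_strong[OF assms(1)]) (rule Suc.prems)
  then have d0: "d 0 = 0" by (simp add: tendsto_const_iff)
  show ?case
  proof (rule Suc.IH)
    fix x :: complex assume x: "x \<noteq> 0" "norm x < r"
    have "(\<lambda>n. d (Suc n) * x ^ Suc n) sums 0"
      using Suc.prems[OF x] by (subst sums_Suc_iff) (simp add: d0)
    from sums_mult[OF this, of "inverse x"] show "(\<lambda>n. d (Suc n) * x ^ n) sums 0"
      using x by (simp add: field_simps)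
  qed
qed

text \<open>Multiplication by a power \<open>x^K\<close> turns the Laurent polynomial into a
  polynomial with infinitely many roots, which must be zero.\<close>

lemma laurent_zero_imp_coeff_zero:
  fixes e :: "int \<Rightarrow> complex"
  assumes M: "finite M" and X: "infinite X" "0 \<notin> X"
    and zero: "\<And>x. x \<in> X \<Longrightarrow> (\<Sum>m\<in>M. e m * x powi m) = 0"
    and m: "m \<in> M"
  shows "e m = 0"
proof -
  obtain K :: int where K: "\<And>m. m \<in> M \<Longrightarrow> m + K \<ge> 0"
  proof -
    have "finite (uminus ` M)" using M by simp
    then have "\<And>m. m \<in> M \<Longrightarrow> - m \<le> Max (insert 0 (uminus ` M))"
      by (intro Max_ge) auto
    then show ?thesis
      using that[of "Max (insert 0 (uminus ` M))"] by fastforce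
  qed
  define p where "p = (\<Sum>m\<in>M. monom (e m) (nat (m + K)))"
  have "poly p x = 0" if x: "x \<in> X" for x
  proof -
    have x0: "x \<noteq> 0" using x X by auto
    have "poly p x = (\<Sum>m\<in>M. e m * x ^ nat (m + K))"
      by (simp add: p_def poly_sum poly_monom)
    also have "\<dots> = (\<Sum>m\<in>M. e m * x powi m * x powi K)"
    proof (rule sum.cong)
      fix m assume "m \<in> M"
      then have "x ^ nat (m + K) = x powi (m + K)"
        using K by (simp add: power_int_def)
      then show "e m * x ^ nat (m + K) = e m * x powi m * x powi K"
        using x0 by (simp add: power_int_add mult.assoc)
    qed simp
    also have "\<dots> = 0"
      using zero[OF x] by (simp flip: sum_distrib_right)
    finally show ?thesis .
  qed
  then have "X \<subseteq> {x. poly p x = 0}" by auto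
  then have "p = 0"
    using poly_roots_finite[of p] X finite_subset by blast
  \<comment> \<open>All exponents \<open>m + K\<close> are nonnegative, so \<open>nat\<close> is
    injective on them and no two monomials share a degree.\<close>
  have "coeff p (nat (m + K)) = (\<Sum>i\<in>M. if i = m then e m else 0)"
    unfolding p_def coeff_sum
  proof (rule sum.cong)
    fix i assume i: "i \<in> M"
    have "nat (i + K) = nat (m + K) \<longleftrightarrow> i = m"
      using K[OF i] K[OF m] by (auto simp: nat_eq_iff)
    then show "coeff (monom (e i) (nat (i + K))) (nat (m + K)) = (if i = m then e m else 0)"
      by auto
  qed simp
  with \<open>p = 0\<close> M m show ?thesis by simp
qed

text \<open>For fixed \<open>x\<close> the difference vanishes as a power series in
  \<open>q\<close>, so each of its coefficients, a Laurent polynomial in \<open>x\<close>, vanishes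
  at infinitely many points. This makes the definite description in \<open>gf_coeff\<close>
  meaningful.\<close>

lemma is_gf_coeffs_unique:
  assumes c: "is_gf_coeffs F c" and c': "is_gf_coeffs F c'"
  shows "c = c'"
proof (intro ext)
  fix m n
  define M where "M = (\<lambda>n. {m. c m n \<noteq> 0} \<union> {m. c' m n \<noteq> 0})"
  have finM: "finite (M n)" for n
    using c c' by (auto simp: M_def is_gf_coeffs_def)
  \<comment> \<open>For \<open>1/2 < x < 2\<close> every \<open>q\<close> of norm below
    \<open>1/2\<close> satisfies \<open>|q| < x\<close> and \<open>x |q| < 1\<close>, so one disc in
    \<open>q\<close> serves all \<open>x\<close>.\<close>
  define X where "X = complex_of_real ` {1/2<..<2}"
  have zero: "(\<Sum>m\<in>M n. (of_int (c m n) - of_int (c' m n)) * x powi m) = 0" if "x \<in> X" for x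
  proof (rule powser_zero_imp_coeff_zero)
    fix q :: complex assume q: "norm q < 1/2"
    from that obtain t :: real where t: "x = of_real t" "1/2 < t" "t < 2"
      by (auto simp: X_def)
    have "t * norm q < 2 * (1/2)"
      using t q by (intro mult_strict_mono) auto
    then have region: "gf_region x q"
      using t q by (simp add: gf_region_def)
    have sums: "(\<lambda>n. (\<Sum>m\<in>M n. of_int (b m n) * x powi m) * q ^ n) sums F x q"
      if b: "b = c \<or> b = c'" for b
    proof -
      have "(\<Sum>m\<in>{m. b m n \<noteq> 0}. of_int (b m n) * x powi m) = (\<Sum>m\<in>M n. of_int (b m n) * x powi m)" for n
        using b by (intro sum.mono_neutral_left finM) (auto simp: M_def)
      moreover have "(\<lambda>n. (\<Sum>m\<in>{m. b m n \<noteq> 0}. of_int (b m n) * x powi m) * q ^ n) sums F x q"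
        using b c c' region unfolding is_gf_coeffs_def by blast
      ultimately show ?thesis by simp
    qed
    have "(\<lambda>n. (\<Sum>m\<in>M n. of_int (c m n) * x powi m) * q ^ n -
        (\<Sum>m\<in>M n. of_int (c' m n) * x powi m) * q ^ n) sums (F x q - F x q)"
      by (intro sums_diff sums) auto
    then show "(\<lambda>n. (\<Sum>m\<in>M n. (of_int (c m n) - of_int (c' m n)) * x powi m) * q ^ n) sums 0"
      by (simp add: left_diff_distrib sum_subtractf)
  qed simp
  have X: "infinite X"
    unfolding X_def by (subst finite_image_iff) (auto simp: inj_on_def)
  have X0: "0 \<notin> X" by (auto simp: X_def)
  have "of_int (c m n) - of_int (c' m n) = (0::complex)" if "m \<in> M n"
    by (rule laurent_zero_imp_coeff_zero[OF finM X X0 zero that])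
  then show "c m n = c' m n"
    by (cases "m \<in> M n") (auto simp: M_def)
qed

lemma gf_coeff_eqI:
  assumes "is_gf_coeffs F c"
  shows "gf_coeff F m n = c m n"
proof -
  have "(THE c. is_gf_coeffs F c) = c"
  proof (rule the_equality)
    show "is_gf_coeffs F c" by (rule assms)
    show "c' = c" if "is_gf_coeffs F c'" for c'
      by (rule is_gf_coeffs_unique[OF that assms])
  qed
  then show ?thesis by (simp add: gf_coeff_def)
qed

lemma gf_coeff_SPbar:
  assumes A: "A = {v \<in> SPbar. spart (fst v) \<in> range f}"
    and f: "inj f" "\<And>n. f n > (0::nat)"
    and F: "\<And>z q. F z q = (\<Sum>n. crank_term z q (f n))"
  shows "gf_coeff F m n = int (card {v \<in> A. pair_size v = n \<and> crank_bar v = m})"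
proof -
  have "is_gf_coeffs F (\<lambda>m n. int (card {v \<in> A. pair_size v = n \<and> crank_bar v = m}))"
    by (rule is_gf_coeffs_card) (auto simp: A F intro!: has_sum_SPbar_enumeration f)
  then show ?thesis by (rule gf_coeff_eqI)
qed

lemma spart_pos: "v \<in> SPbar \<Longrightarrow> spart (fst v) > 0"
  using spart_in[of "fst v"] by (cases "spart (fst v)") (auto simp: SPbar_def is_partition_def)

theorem theorem3p1:
  fixes m :: int and n :: nat
  assumes "n \<ge> 1"
  shows "N_S m n = int (card {v \<in> SPbar. pair_size v = n \<and> crank_bar v = m}) \<and>
         N_S1 m n = int (card {v \<in> SPbar1. pair_size v = n \<and> crank_bar v = m}) \<and>
         N_S2 m n = int (card {v \<in> SPbar2. pair_size v = n \<and> crank_bar v = m})"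
proof (intro conjI)
  \<comment> \<open>The three claims differ only in the enumeration of the smallest parts:
    \<open>Suc\<close>, \<open>2 * n + 1\<close> and \<open>2 * Suc n\<close>.\<close>
  have "SPbar = {v \<in> SPbar. spart (fst v) \<in> range Suc}"
    using spart_pos by (auto simp: image_iff gr0_conv_Suc)
  then show "N_S m n = int (card {v \<in> SPbar. pair_size v = n \<and> crank_bar v = m})"
    unfolding N_S_def by (rule gf_coeff_SPbar) (simp_all add: GF_S_def crank_term_def Let_def)
  have "SPbar1 = {v \<in> SPbar. spart (fst v) \<in> range (\<lambda>n. 2 * n + 1)}"
    by (auto simp: SPbar1_def image_iff elim!: oddE)
  then show "N_S1 m n = int (card {v \<in> SPbar1. pair_size v = n \<and> crank_bar v = m})"
    unfolding N_S1_def by (rule gf_coeff_SPbar) (simp_all add: inj_def GF_S1_def crank_term_def)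
  have "\<exists>k. s = 2 * Suc k" if "even s" "s > 0" for s :: nat
  proof -
    from that obtain j where "s = 2 * j" "j > 0" by (auto elim!: evenE)
    then have "s = 2 * Suc (j - 1)" by simp
    then show ?thesis ..
  qed
  then have "SPbar2 = {v \<in> SPbar. spart (fst v) \<in> range (\<lambda>n. 2 * Suc n)}"
    using spart_pos by (auto simp: SPbar2_def image_iff)
  then show "N_S2 m n = int (card {v \<in> SPbar2. pair_size v = n \<and> crank_bar v = m})"
    unfolding N_S2_def by (rule gf_coeff_SPbar) (simp_all add: inj_def GF_S2_def crank_term_def Let_def)
qed

end
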